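(* Let $\Omega\subset\mathbb{R}^d$ ($d=2,3$) be a bounded two-phase isotropic body with complex phase conductivities $\sigma^{(\alpha)}=\sigma_1^{(\alpha)}+i\sigma_2^{(\alpha)}$, $\alpha=1,2$, such that $\beta=\sigma_1^{(1)}\sigma_2^{(2)}-\sigma_2^{(1)}\sigma_1^{(2)}\ne0$, with (known) nonzero volume fractions $f_1,f_2$ and thresholds $c^{(1)},c^{(2)}>0$. Let $\mathbf{E}=\mathbf{E}_1+i\mathbf{E}_2$, $\mathbf{J}=\mathbf{J}_1+i\mathbf{J}_2$ be complex fields solving the quasistatic equations in $\Omega$. If the material has not experienced the onset of nonlinearities, then the feasible region $$\{(x,y)\in\mathbb{R}^2:\ \mathbf{S}^{(1)}(x,y)\ \text{and}\ \mathbf{S}^{(2)}(x,y)\ \text{are positive semidefinite}\}$$ (the region of intersection of the two ellipses given by the constraints on $\mathbf{S}^{(1)}$ and $\mathbf{S}^{(2)}$) is nonempty and intersects the compatible region, where the matrices $\mathbf{S}^{(\alpha)}(x,y)$ and the compatible region are defined in the context.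
   Context: Phase $\alpha$ occupies $\Omega_\alpha\subset\Omega$ with characteristic function $\chi_\alpha$ ($\chi_1+\chi_2=1$ in $\Omega$ up to measure zero), and $f_\alpha=|\Omega_\alpha|/|\Omega|$. $\langle\cdot\rangle$ is the average over $\Omega$. Subscripts $1$ and $2$ on conductivities and fields denote real and imaginary parts. The quasistatic equations are $\mathbf{J}=\sigma\mathbf{E}$, $\nabla\cdot\mathbf{J}=0$, $\mathbf{E}=-\nabla V$, with complex square-integrable fields and $\sigma=\sigma^{(1)}\chi_1+\sigma^{(2)}\chi_2$. Put $\mathbf{E}_m^{(\alpha)}=\chi_\alpha\mathbf{E}_m$. Onset of nonlinearities at a point $\mathbf{x}$ of phase $\alpha$ is the condition $|\mathbf{E}_1(\mathbf{x})|^2+|\mathbf{E}_2(\mathbf{x})|^2\ge(c^{(\alpha)})^2$; the material has not experienced it if $|\mathbf{E}_1|^2+|\mathbf{E}_2|^2<(c^{(\alpha)})^2$ (almost) everywhere in $\Omega_\alpha$, $\alpha=1,2$. Put $\gamma=(\sigma_1^{(1)}\sigma_1^{(2)}+\sigma_2^{(1)}\sigma_2^{(2)})/\beta$, $\psi^{(1)}=|\sigma^{(2)}|^2/\beta$, $\psi^{(2)}=|\sigma^{(1)}|^2/\beta$, $$\xi^{(1)}=\frac{\sigma_2^{(2)}\langle\mathbf{E}_1\cdot\mathbf{J}_2\rangle+\sigma_1^{(2)}\langle\mathbf{E}_1\cdot\mathbf{J}_1\rangle}{\beta},\qquad \xi^{(2)}=\frac{\sigma_2^{(1)}\langle\mathbf{E}_1\cdot\mathbf{J}_2\rangle+\sigma_1^{(1)}\langle\mathbf{E}_1\cdot\mathbf{J}_1\rangle}{\beta},$$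 $$\eta^{(1)}=\frac{\sigma_1^{(2)}(\langle\mathbf{E}_2\cdot\mathbf{J}_1\rangle-\langle\mathbf{E}_1\cdot\mathbf{J}_2\rangle)+\sigma_2^{(2)}(\langle\mathbf{E}_1\cdot\mathbf{J}_1\rangle+\langle\mathbf{E}_2\cdot\mathbf{J}_2\rangle)}{\beta},$$ $$\eta^{(2)}=\frac{\sigma_1^{(1)}(\langle\mathbf{E}_1\cdot\mathbf{J}_2\rangle-\langle\mathbf{E}_2\cdot\mathbf{J}_1\rangle)-\sigma_2^{(1)}(\langle\mathbf{E}_1\cdot\mathbf{J}_1\rangle+\langle\mathbf{E}_2\cdot\mathbf{J}_2\rangle)}{\beta}.$$ For $(x,y)\in\mathbb{R}^2$ define the symmetric $2\times2$ matrices $\mathbf{S}^{(\alpha)}(x,y)$ with entries $S_{11}^{(1)}=x-|\langle\mathbf{E}_1^{(1)}\rangle|^2/f_1$, $S_{22}^{(1)}=-x+\eta^{(1)}-|\langle\mathbf{E}_2^{(1)}\rangle|^2/f_1$, $S_{21}^{(1)}=-\gamma x-\psi^{(1)}y+\xi^{(1)}-\langle\mathbf{E}_1^{(1)}\rangle\cdot\langle\mathbf{E}_2^{(1)}\rangle/f_1$; $S_{11}^{(2)}=y-|\langle\mathbf{E}_1^{(2)}\rangle|^2/f_2$, $S_{22}^{(2)}=-y+\eta^{(2)}-|\langle\mathbf{E}_2^{(2)}\rangle|^2/f_2$, $S_{21}^{(2)}=\psi^{(2)}x+\gamma y-\xi^{(2)}-\langle\mathbf{E}_1^{(2)}\rangle\cdot\langle\mathbf{E}_2^{(2)}\rangle/f_2$.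 Here $x$ and $y$ play the roles of $A_{11}^{(1)}$ and $A_{11}^{(2)}$, where $A_{mn}^{(\alpha)}=\langle\mathbf{E}_m^{(\alpha)}\cdot\mathbf{E}_n^{(\alpha)}\rangle$. The compatible region is the set of $(x,y)\in\mathbb{R}^2$ satisfying, for $\alpha=1,2$, $A_{11}^{(\alpha)}+A_{22}^{(\alpha)}\le f_\alpha(c^{(\alpha)})^2$, where here $A_{11}^{(1)}=x$, $A_{11}^{(2)}=y$, and $A_{22}^{(1)},A_{22}^{(2)}$ are expressed through $(x,y)$ by solving the linear system $$\begin{bmatrix}-\sigma_2^{(1)}&-\sigma_2^{(2)}&0&0\\ \sigma_1^{(1)}&\sigma_1^{(2)}&0&0\\ \sigma_1^{(1)}&\sigma_1^{(2)}&-\sigma_2^{(1)}&-\sigma_2^{(2)}\\ \sigma_2^{(1)}&\sigma_2^{(2)}&\sigma_1^{(1)}&\sigma_1^{(2)}\end{bmatrix}\begin{bmatrix} A_{21}^{(1)} \\ A_{21}^{(2)} \\ A_{22}^{(1)} \\ A_{22}^{(2)} \end{bmatrix}=\begin{bmatrix}\langle\mathbf{E}_1\cdot\mathbf{J}_1\rangle-\sigma_1^{(1)}x-\sigma_1^{(2)}y\\ \langle\mathbf{E}_1\cdot\mathbf{J}_2\rangle-\sigma_2^{(1)}x-\sigma_2^{(2)}y\\ \langle\mathbf{E}_2\cdot\mathbf{J}_1\rangle\\ \langle\mathbf{E}_2\cdot\mathbf{J}_2\rangle\end{bmatrix}.$$ *)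

theory Defs
  imports "HOL-Analysis.Analysis"
begin

text \<open>
  The numeral type \<open>2\<close> (elements \<open>1\<close> and \<open>2\<close>) indexes both the two phases and the real
  (\<open>1\<close>) and imaginary (\<open>2\<close>) parts of a complex quantity; \<open>P \<alpha>\<close> is the region occupied by phase \<open>\<alpha>\<close>
  and \<open>s \<alpha>\<close> its conductivity.
\<close>

definition part :: "2 \<Rightarrow> complex ^ 'n \<Rightarrow> real ^ 'n" where
  "part m z = (\<chi> i. if m = 1 then Re (z $ i) else Im (z $ i))"

primrec Ck :: "nat \<Rightarrow> ('a::real_normed_vector \<Rightarrow> real) \<Rightarrow> bool" where
  "Ck 0 f \<longleftrightarrow> continuous_on UNIV f"
| "Ck (Suc k) f \<longleftrightarrow>
     (\<exists>f'. (\<forall>x. (f has_derivative f' x) (at x)) \<and> (\<forall>v. Ck k (\<lambda>x. f' x v)))"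

definition test_function :: "(real ^ 'n) set \<Rightarrow> (real ^ 'n \<Rightarrow> real) \<Rightarrow> bool" where
  "test_function \<Omega> \<phi> \<longleftrightarrow>
     (\<forall>k. Ck k \<phi>) \<and> compact (closure {x. \<phi> x \<noteq> 0}) \<and> closure {x. \<phi> x \<noteq> 0} \<subseteq> \<Omega>"

definition partial_deriv :: "'n \<Rightarrow> (real ^ 'n \<Rightarrow> real) \<Rightarrow> real ^ 'n \<Rightarrow> real" where
  "partial_deriv i \<phi> x = frechet_derivative \<phi> (at x) (axis i 1)"

definition weak_gradient ::
    "(real ^ 'n) set \<Rightarrow> (real ^ 'n \<Rightarrow> complex) \<Rightarrow> (real ^ 'n \<Rightarrow> complex ^ 'n) \<Rightarrow> bool" where
  "weak_gradient \<Omega> V G \<longleftrightarrow>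
     (\<forall>K. compact K \<and> K \<subseteq> \<Omega> \<longrightarrow> V absolutely_integrable_on K) \<and>
     (\<forall>\<phi> i. test_function \<Omega> \<phi> \<longrightarrow>
        (LINT x|lebesgue_on \<Omega>. V x * of_real (partial_deriv i \<phi> x)) =
        - (LINT x|lebesgue_on \<Omega>. G x $ i * of_real (\<phi> x)))"

definition weakly_divergence_free :: "(real ^ 'n) set \<Rightarrow> (real ^ 'n \<Rightarrow> complex ^ 'n) \<Rightarrow> bool" where
  "weakly_divergence_free \<Omega> J \<longleftrightarrow>
     (\<forall>\<phi>. test_function \<Omega> \<phi> \<longrightarrow>
        (LINT x|lebesgue_on \<Omega>. (\<Sum>i\<in>UNIV. J x $ i * of_real (partial_deriv i \<phi> x))) = 0)"

definition square_integrable_field ::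
    "(real ^ 'n) set \<Rightarrow> (real ^ 'n \<Rightarrow> complex ^ 'n) \<Rightarrow> bool" where
  "square_integrable_field \<Omega> F \<longleftrightarrow>
     F \<in> borel_measurable (lebesgue_on \<Omega>) \<and> integrable (lebesgue_on \<Omega>) (\<lambda>x. (norm (F x))\<^sup>2)"

definition quasistatic_solution ::
    "(real ^ 'n) set \<Rightarrow> (real ^ 'n \<Rightarrow> complex) \<Rightarrow>
     (real ^ 'n \<Rightarrow> complex ^ 'n) \<Rightarrow> (real ^ 'n \<Rightarrow> complex ^ 'n) \<Rightarrow> bool" where
  "quasistatic_solution \<Omega> \<sigma> E J \<longleftrightarrow>
     square_integrable_field \<Omega> E \<and> square_integrable_field \<Omega> J \<and>
     (AE x in lebesgue_on \<Omega>. J x = \<sigma> x *s E x) \<and>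
     weakly_divergence_free \<Omega> J \<and>
     (\<exists>V. weak_gradient \<Omega> V (\<lambda>x. - E x))"

definition two_phase_body :: "(real ^ 'n) set \<Rightarrow> (2 \<Rightarrow> (real ^ 'n) set) \<Rightarrow> bool" where
  "two_phase_body \<Omega> P \<longleftrightarrow>
     open \<Omega> \<and> bounded \<Omega> \<and> \<Omega> \<noteq> {} \<and>
     (\<forall>\<alpha>. P \<alpha> \<in> sets lebesgue \<and> P \<alpha> \<subseteq> \<Omega>) \<and>
     (AE x in lebesgue_on \<Omega>. indicator (P 1) x + indicator (P 2) x = (1::real))"

definition conductivity ::
    "(2 \<Rightarrow> (real ^ 'n) set) \<Rightarrow> (2 \<Rightarrow> complex) \<Rightarrow> real ^ 'n \<Rightarrow> complex" where
  "conductivity P s x = s 1 * indicator (P 1) x + s 2 * indicator (P 2) x"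

definition volume_fraction :: "(real ^ 'n) set \<Rightarrow> (2 \<Rightarrow> (real ^ 'n) set) \<Rightarrow> 2 \<Rightarrow> real" where
  "volume_fraction \<Omega> P \<alpha> = measure lebesgue (P \<alpha>) / measure lebesgue \<Omega>"

definition no_onset ::
    "(2 \<Rightarrow> (real ^ 'n) set) \<Rightarrow> (2 \<Rightarrow> real) \<Rightarrow> (real ^ 'n \<Rightarrow> complex ^ 'n) \<Rightarrow> bool" where
  "no_onset P c E \<longleftrightarrow>
     (\<forall>\<alpha>. AE x in lebesgue_on (P \<alpha>).
        (norm (part 1 (E x)))\<^sup>2 + (norm (part 2 (E x)))\<^sup>2 < (c \<alpha>)\<^sup>2)"

definition avg :: "(real ^ 'n) set \<Rightarrow> (real ^ 'n \<Rightarrow> 'b::{banach, second_countable_topology}) \<Rightarrow> 'b"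
  where "avg \<Omega> g = integral\<^sup>L (lebesgue_on \<Omega>) g /\<^sub>R measure lebesgue \<Omega>"

text \<open>\<open>EJ \<Omega> E J $ m $ n\<close> is \<open>\<langle>E\<^sub>m \<bullet> J\<^sub>n\<rangle>\<close>, and \<open>phase_mean \<Omega> P E \<alpha> m\<close> is \<open>\<langle>\<chi>\<^sub>\<alpha> E\<^sub>m\<rangle>\<close>.\<close>

definition EJ ::
    "(real ^ 'n) set \<Rightarrow> (real ^ 'n \<Rightarrow> complex ^ 'n) \<Rightarrow> (real ^ 'n \<Rightarrow> complex ^ 'n) \<Rightarrow> real ^ 2 ^ 2" where
  "EJ \<Omega> E J = (\<chi> m n. avg \<Omega> (\<lambda>x. part m (E x) \<bullet> part n (J x)))"

definition phase_mean ::
    "(real ^ 'n) set \<Rightarrow> (2 \<Rightarrow> (real ^ 'n) set) \<Rightarrow> (real ^ 'n \<Rightarrow> complex ^ 'n) \<Rightarrow> 2 \<Rightarrow> 2 \<Rightarrow> real ^ 'n" where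
  "phase_mean \<Omega> P E \<alpha> m = avg \<Omega> (\<lambda>x. indicator (P \<alpha>) x *\<^sub>R part m (E x))"

text \<open>Below, \<open>W\<close> stands for the matrix \<open>EJ \<Omega> E J\<close>.\<close>

definition beta :: "(2 \<Rightarrow> complex) \<Rightarrow> real" where
  "beta s = Re (s 1) * Im (s 2) - Im (s 1) * Re (s 2)"

definition gamma :: "(2 \<Rightarrow> complex) \<Rightarrow> real" where
  "gamma s = (Re (s 1) * Re (s 2) + Im (s 1) * Im (s 2)) / beta s"

definition psi1 :: "(2 \<Rightarrow> complex) \<Rightarrow> real" where
  "psi1 s = (cmod (s 2))\<^sup>2 / beta s"

definition psi2 :: "(2 \<Rightarrow> complex) \<Rightarrow> real" where
  "psi2 s = (cmod (s 1))\<^sup>2 / beta s"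

definition xi1 :: "(2 \<Rightarrow> complex) \<Rightarrow> real ^ 2 ^ 2 \<Rightarrow> real" where
  "xi1 s W = (Im (s 2) * W $ 1 $ 2 + Re (s 2) * W $ 1 $ 1) / beta s"

definition xi2 :: "(2 \<Rightarrow> complex) \<Rightarrow> real ^ 2 ^ 2 \<Rightarrow> real" where
  "xi2 s W = (Im (s 1) * W $ 1 $ 2 + Re (s 1) * W $ 1 $ 1) / beta s"

definition eta1 :: "(2 \<Rightarrow> complex) \<Rightarrow> real ^ 2 ^ 2 \<Rightarrow> real" where
  "eta1 s W =
     (Re (s 2) * (W $ 2 $ 1 - W $ 1 $ 2) + Im (s 2) * (W $ 1 $ 1 + W $ 2 $ 2)) / beta s"

definition eta2 :: "(2 \<Rightarrow> complex) \<Rightarrow> real ^ 2 ^ 2 \<Rightarrow> real" where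
  "eta2 s W =
     (Re (s 1) * (W $ 1 $ 2 - W $ 2 $ 1) - Im (s 1) * (W $ 1 $ 1 + W $ 2 $ 2)) / beta s"

text \<open>
  In \<open>S1\<close> and \<open>S2\<close>, \<open>f\<close> is the volume fraction of the phase and
  \<open>e m = \<langle>\<chi>\<^sub>\<alpha> E\<^sub>m\<rangle>\<close>.
\<close>

definition sym_mat2 :: "real \<Rightarrow> real \<Rightarrow> real \<Rightarrow> real ^ 2 ^ 2" where
  "sym_mat2 a11 a21 a22 = vector [vector [a11, a21], vector [a21, a22]]"

definition S1 ::
    "(2 \<Rightarrow> complex) \<Rightarrow> real ^ 2 ^ 2 \<Rightarrow> real \<Rightarrow> (2 \<Rightarrow> real ^ 'n) \<Rightarrow> real \<Rightarrow> real \<Rightarrow> real ^ 2 ^ 2" where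
  "S1 s W f e x y = sym_mat2
     (x - (norm (e 1))\<^sup>2 / f)
     (- gamma s * x - psi1 s * y + xi1 s W - (e 1 \<bullet> e 2) / f)
     (- x + eta1 s W - (norm (e 2))\<^sup>2 / f)"

definition S2 ::
    "(2 \<Rightarrow> complex) \<Rightarrow> real ^ 2 ^ 2 \<Rightarrow> real \<Rightarrow> (2 \<Rightarrow> real ^ 'n) \<Rightarrow> real \<Rightarrow> real \<Rightarrow> real ^ 2 ^ 2" where
  "S2 s W f e x y = sym_mat2
     (y - (norm (e 1))\<^sup>2 / f)
     (psi2 s * x + gamma s * y - xi2 s W - (e 1 \<bullet> e 2) / f)
     (- y + eta2 s W - (norm (e 2))\<^sup>2 / f)"

definition positive_semidefinite :: "real ^ 'm ^ 'm \<Rightarrow> bool" where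
  "positive_semidefinite A \<longleftrightarrow> transpose A = A \<and> (\<forall>v. 0 \<le> v \<bullet> (A *v v))"

definition feasible_region ::
    "(real ^ 'n) set \<Rightarrow> (2 \<Rightarrow> (real ^ 'n) set) \<Rightarrow> (2 \<Rightarrow> complex) \<Rightarrow>
     (real ^ 'n \<Rightarrow> complex ^ 'n) \<Rightarrow> (real ^ 'n \<Rightarrow> complex ^ 'n) \<Rightarrow> (real \<times> real) set" where
  "feasible_region \<Omega> P s E J =
     {(x, y).
        positive_semidefinite
          (S1 s (EJ \<Omega> E J) (volume_fraction \<Omega> P 1) (phase_mean \<Omega> P E 1) x y) \<and>
        positive_semidefinite
          (S2 s (EJ \<Omega> E J) (volume_fraction \<Omega> P 2) (phase_mean \<Omega> P E 2) x y)}"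

text \<open>
  The linear system has determinant \<open>(beta s)\<^sup>2\<close>, so the vector \<open>A\<close> in
  \<open>compatible_region\<close>, whose entries are \<open>A\<^sub>2\<^sub>1\<close> in phases 1 and 2 followed by
  \<open>A\<^sub>2\<^sub>2\<close> in phases 1 and 2, exists and is unique whenever \<open>beta s \<noteq> 0\<close>.
\<close>

definition system_matrix :: "(2 \<Rightarrow> complex) \<Rightarrow> real ^ 4 ^ 4" where
  "system_matrix s = vector
     [vector [- Im (s 1), - Im (s 2), 0, 0],
      vector [Re (s 1), Re (s 2), 0, 0],
      vector [Re (s 1), Re (s 2), - Im (s 1), - Im (s 2)],
      vector [Im (s 1), Im (s 2), Re (s 1), Re (s 2)]]"

definition system_rhs :: "(2 \<Rightarrow> complex) \<Rightarrow> real ^ 2 ^ 2 \<Rightarrow> real \<Rightarrow> real \<Rightarrow> real ^ 4" where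
  "system_rhs s W x y = vector
     [W $ 1 $ 1 - Re (s 1) * x - Re (s 2) * y,
      W $ 1 $ 2 - Im (s 1) * x - Im (s 2) * y,
      W $ 2 $ 1,
      W $ 2 $ 2]"

definition compatible_region ::
    "(real ^ 'n) set \<Rightarrow> (2 \<Rightarrow> (real ^ 'n) set) \<Rightarrow> (2 \<Rightarrow> complex) \<Rightarrow> (2 \<Rightarrow> real) \<Rightarrow>
     (real ^ 'n \<Rightarrow> complex ^ 'n) \<Rightarrow> (real ^ 'n \<Rightarrow> complex ^ 'n) \<Rightarrow> (real \<times> real) set" where
  "compatible_region \<Omega> P s c E J =
     {(x, y). \<exists>A. system_matrix s *v A = system_rhs s (EJ \<Omega> E J) x y \<and>
        x + A $ 3 \<le> volume_fraction \<Omega> P 1 * (c 1)\<^sup>2 \<and>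
        y + A $ 4 \<le> volume_fraction \<Omega> P 2 * (c 2)\<^sup>2}"

end

theory Submission
  imports Defs
begin

text \<open>
  The point \<open>x = \<langle>E\<^sub>1\<^sup>(\<^sup>1\<^sup>) \<bullet> E\<^sub>1\<^sup>(\<^sup>1\<^sup>)\<rangle>\<close>, \<open>y = \<langle>E\<^sub>1\<^sup>(\<^sup>2\<^sup>) \<bullet> E\<^sub>1\<^sup>(\<^sup>2\<^sup>)\<rangle>\<close> given by the actual field lies in both regions.
  Expanding \<open>J = \<sigma> E\<close> shows that the remaining second moments of \<open>E\<close> over the phases solve the linear
  system, and solving it identifies the matrices \<open>S\<close> at this point with covariance matrices of
  \<open>(E\<^sub>1, E\<^sub>2)\<close> over each phase, which are positive semidefinite. Integrating the pointwise threshold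
  inequality over each phase gives compatibility.
\<close>

section \<open>Real and imaginary parts of square-integrable complex fields\<close>

lemma part_vector_scale:
  "part 1 (a *s z) = Re a *\<^sub>R part 1 z - Im a *\<^sub>R part 2 z"
  "part 2 (a *s z) = Im a *\<^sub>R part 1 z + Re a *\<^sub>R part 2 z"
  by (simp_all add: part_def vec_eq_iff algebra_simps)

lemma norm_parts: "(norm (part 1 z))\<^sup>2 + (norm (part 2 z))\<^sup>2 = (norm z)\<^sup>2"
proof -
  have "(norm z)\<^sup>2 = (\<Sum>i\<in>UNIV. (norm (z $ i))\<^sup>2)"
    by (simp add: norm_vec_def L2_set_def sum_nonneg)
  moreover have "(norm w)\<^sup>2 = (\<Sum>i\<in>UNIV. (w $ i)\<^sup>2)" for w :: "real ^ 'a"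
    by (simp add: norm_vec_def L2_set_def sum_nonneg)
  ultimately show ?thesis
    by (simp add: part_def cmod_power2 sum.distrib)
qed

lemma norm_part_le: "norm (part m z) \<le> norm z"
proof -
  have "(norm (part m z))\<^sup>2 \<le> (norm z)\<^sup>2"
    using exhaust_2[of m] unfolding norm_parts[of z, symmetric] by auto
  then show ?thesis by (rule power2_le_imp_le) simp
qed

lemma borel_measurable_part [measurable]:
  "(part m :: complex ^ 'n \<Rightarrow> real ^ 'n) \<in> borel_measurable borel"
proof (rule borel_measurable_continuous_onI)
  show "continuous_on UNIV (part m :: complex ^ 'n \<Rightarrow> real ^ 'n)"
    unfolding part_def by (cases "m = 1") (auto intro!: continuous_intros)
qed

text \<open>Cauchy-Schwarz bounds the integrand by \<open>norm (E x) * norm (F x)\<close>, and the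
  sum of the two squared norms is an integrable majorant of that product.\<close>

lemma integrable_part_inner:
  assumes E: "square_integrable_field \<Omega> E" and F: "square_integrable_field \<Omega> F"
  shows "integrable (lebesgue_on \<Omega>) (\<lambda>x. part m (E x) \<bullet> part n (F x))"
proof (rule Bochner_Integration.integrable_bound)
  have [measurable]: "E \<in> borel_measurable (lebesgue_on \<Omega>)" "F \<in> borel_measurable (lebesgue_on \<Omega>)"
    using E F by (auto simp: square_integrable_field_def)
  show "(\<lambda>x. part m (E x) \<bullet> part n (F x)) \<in> borel_measurable (lebesgue_on \<Omega>)"
    by measurable
  show "integrable (lebesgue_on \<Omega>) (\<lambda>x. (norm (E x))\<^sup>2 + (norm (F x))\<^sup>2)"
    using E F by (auto simp: square_integrable_field_def)
  have "norm (part m (E x) \<bullet> part n (F x)) \<le> norm ((norm (E x))\<^sup>2 + (norm (F x))\<^sup>2)" for x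
  proof -
    have "norm (part m (E x) \<bullet> part n (F x)) \<le> norm (part m (E x)) * norm (part n (F x))"
      using Cauchy_Schwarz_ineq2 by simp
    also have "\<dots> \<le> norm (E x) * norm (F x)"
      by (intro mult_mono norm_part_le) auto
    also have "\<dots> \<le> (norm (E x))\<^sup>2 + (norm (F x))\<^sup>2"
      using sum_squares_bound[of "norm (E x)" "norm (F x)"]
        mult_nonneg_nonneg[OF norm_ge_zero[of "E x"] norm_ge_zero[of "F x"]] by linarith
    finally show ?thesis by simp
  qed
  then show "AE x in lebesgue_on \<Omega>.
      norm (part m (E x) \<bullet> part n (F x)) \<le> norm ((norm (E x))\<^sup>2 + (norm (F x))\<^sup>2)" by simp
qed

text \<open>On a set of finite measure the constant 1 is integrable, so
  \<open>t \<le> 1 + t\<^sup>2\<close> with \<open>t = norm (E x)\<close> turns square integrability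
  into integrability. This makes the phase means genuine integrals.\<close>

lemma integrable_part:
  assumes E: "square_integrable_field \<Omega> E" and "\<Omega> \<in> lmeasurable"
  shows "integrable (lebesgue_on \<Omega>) (\<lambda>x. part m (E x))"
proof (rule Bochner_Integration.integrable_bound)
  interpret finite_measure "lebesgue_on \<Omega>"
    using assms(2) by (rule finite_measure_lebesgue_on)
  have [measurable]: "E \<in> borel_measurable (lebesgue_on \<Omega>)"
    using E by (auto simp: square_integrable_field_def)
  show "(\<lambda>x. part m (E x)) \<in> borel_measurable (lebesgue_on \<Omega>)"
    by measurable
  show "integrable (lebesgue_on \<Omega>) (\<lambda>x. 1 + (norm (E x))\<^sup>2)"
    using E by (auto simp: square_integrable_field_def)
  have "norm (part m (E x)) \<le> norm (1 + (norm (E x))\<^sup>2)" for x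
  proof -
    have "norm (part m (E x)) \<le> norm (E x)" by (rule norm_part_le)
    also have "\<dots> \<le> 1 + (norm (E x))\<^sup>2"
      using sum_squares_bound[of 1 "norm (E x)"] norm_ge_zero[of "E x"] by (simp, linarith)
    finally show ?thesis by simp
  qed
  then show "AE x in lebesgue_on \<Omega>. norm (part m (E x)) \<le> norm (1 + (norm (E x))\<^sup>2)" by simp
qed

section \<open>Averages over the body and the variance inequality\<close>

lemma sets_lebesgue_on_subset:
  assumes "Q \<in> sets lebesgue" "Q \<subseteq> \<Omega>" "\<Omega> \<in> sets lebesgue"
  shows "Q \<in> sets (lebesgue_on \<Omega>)"
  using assms by (auto simp: sets_restrict_space_iff)

lemma avg_add:
  assumes "integrable (lebesgue_on \<Omega>) g" "integrable (lebesgue_on \<Omega>) h"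
  shows "avg \<Omega> (\<lambda>x. g x + h x) = avg \<Omega> g + avg \<Omega> h"
  using assms by (simp add: avg_def scaleR_add_right)

lemma avg_diff:
  assumes "integrable (lebesgue_on \<Omega>) g" "integrable (lebesgue_on \<Omega>) h"
  shows "avg \<Omega> (\<lambda>x. g x - h x) = avg \<Omega> g - avg \<Omega> h"
  using assms by (simp add: avg_def scaleR_diff_right)

lemma avg_scaleR: "avg \<Omega> (\<lambda>x. k *\<^sub>R g x) = k *\<^sub>R avg \<Omega> g"
  by (simp add: avg_def mult.commute)

lemma avg_mult: "avg \<Omega> (\<lambda>x. k * g x) = k * avg \<Omega> g" for k :: real
  using avg_scaleR[of \<Omega> k g] by simp

lemma avg_indicator:
  assumes "Q \<in> sets lebesgue" "Q \<subseteq> \<Omega>" "\<Omega> \<in> sets lebesgue"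
  shows "avg \<Omega> (indicator Q) = measure lebesgue Q / measure lebesgue \<Omega>"
proof -
  have "integral\<^sup>L (lebesgue_on \<Omega>) (indicator Q) = measure (lebesgue_on \<Omega>) Q"
    using sets_lebesgue_on_subset[OF assms] assms(2) by (simp add: Int_absorb2)
  also have "\<dots> = measure lebesgue Q"
    using assms by (intro measure_restrict_space) auto
  finally show ?thesis by (simp add: avg_def divide_inverse)
qed

text \<open>Nonnegativity of the variance over \<open>Q\<close>: expand \<open>\<langle>\<chi>\<^sub>Q |g - m|\<^sup>2\<rangle> \<ge> 0\<close> with \<open>m = \<langle>\<chi>\<^sub>Q g\<rangle> / f\<close>.\<close>

lemma norm_avg_indicator_le:
  fixes g :: "real ^ 'n \<Rightarrow> real ^ 'n"
  assumes Q: "Q \<in> sets lebesgue" "Q \<subseteq> \<Omega>" and \<Omega>: "\<Omega> \<in> lmeasurable"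
    and f: "f = measure lebesgue Q / measure lebesgue \<Omega>" "f \<noteq> 0"
    and g: "integrable (lebesgue_on \<Omega>) g" "integrable (lebesgue_on \<Omega>) (\<lambda>x. g x \<bullet> g x)"
  shows "(norm (avg \<Omega> (\<lambda>x. indicator Q x *\<^sub>R g x)))\<^sup>2 / f
    \<le> avg \<Omega> (\<lambda>x. indicator Q x * (g x \<bullet> g x))"
proof -
  interpret finite_measure "lebesgue_on \<Omega>"
    using \<Omega> by (rule finite_measure_lebesgue_on)
  have \<Omega>': "\<Omega> \<in> sets lebesgue" using \<Omega> by (rule fmeasurableD)
  have QM [measurable]: "Q \<in> sets (lebesgue_on \<Omega>)"
    using Q \<Omega>' by (intro sets_lebesgue_on_subset)
  define u where "u = avg \<Omega> (\<lambda>x. indicator Q x *\<^sub>R g x)"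
  define m where "m = u /\<^sub>R f"
  have i1: "integrable (lebesgue_on \<Omega>) (\<lambda>x. indicator Q x *\<^sub>R g x)"
    using integrable_mult_indicator[OF QM g(1)] .
  have i2: "integrable (lebesgue_on \<Omega>) (\<lambda>x. indicator Q x * (g x \<bullet> g x))"
    using integrable_mult_indicator[OF QM g(2)] by simp
  have i3: "integrable (lebesgue_on \<Omega>) (indicator Q :: _ \<Rightarrow> real)"
    using QM by (intro integrable_real_indicator) (simp_all add: emeasure_finite less_top[symmetric])
  have eq: "indicator Q x * ((g x - m) \<bullet> (g x - m)) =
      indicator Q x * (g x \<bullet> g x) - 2 * ((indicator Q x *\<^sub>R g x) \<bullet> m) + indicator Q x * (m \<bullet> m)" for x
    by (simp add: algebra_simps inner_commute)
  have "0 \<le> avg \<Omega> (\<lambda>x. indicator Q x * ((g x - m) \<bullet> (g x - m)))"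
    unfolding avg_def
    by (simp add: Bochner_Integration.integral_nonneg)
  also have "\<dots> = avg \<Omega> (\<lambda>x. indicator Q x * (g x \<bullet> g x))
      - 2 * avg \<Omega> (\<lambda>x. (indicator Q x *\<^sub>R g x) \<bullet> m) + avg \<Omega> (\<lambda>x. indicator Q x * (m \<bullet> m))"
    unfolding eq using i1 i2 i3
    by (simp only: avg_add avg_diff avg_mult integrable_mult_right integrable_mult_left
        integrable_inner_left Bochner_Integration.integrable_diff)
  also have "avg \<Omega> (\<lambda>x. (indicator Q x *\<^sub>R g x) \<bullet> m) = u \<bullet> m"
    using integral_inner_left[of m, OF i1] by (simp add: avg_def u_def del: inner_scaleR_left)
      (simp add: inner_scaleR_left)
  also have "avg \<Omega> (\<lambda>x. indicator Q x * (m \<bullet> m)) = avg \<Omega> (indicator Q) * (m \<bullet> m)"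
    by (simp add: avg_def)
  also have "avg \<Omega> (indicator Q) = f"
    unfolding f(1) using Q \<Omega>' by (rule avg_indicator)
  \<comment> \<open>With \<open>m = u /\<^sub>R f\<close>, both \<open>u \<bullet> m\<close> and
    \<open>f * (m \<bullet> m)\<close> equal \<open>(norm u)\<^sup>2 / f\<close>, so the last two
    terms combine to its negative.\<close>
  also have "avg \<Omega> (\<lambda>x. indicator Q x * (g x \<bullet> g x)) - 2 * (u \<bullet> m) + f * (m \<bullet> m) =
      avg \<Omega> (\<lambda>x. indicator Q x * (g x \<bullet> g x)) - (norm u)\<^sup>2 / f"
    using f(2) by (simp add: m_def power2_norm_eq_inner field_simps)
  finally show ?thesis by (simp add: u_def)
qed

section \<open>Positive semidefinite two-by-two matrices\<close>

lemma vector_4 [simp]: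
  "(vector [x, y, z, w] :: ('a::zero) ^ 4) $ 1 = x"
  "(vector [x, y, z, w] :: ('a::zero) ^ 4) $ 2 = y"
  "(vector [x, y, z, w] :: ('a::zero) ^ 4) $ 3 = z"
  "(vector [x, y, z, w] :: ('a::zero) ^ 4) $ 4 = w"
  unfolding vector_def by simp_all

text \<open>Every pair \<open>p\<close>, \<open>q\<close> is the pair of entries of some vector in
  the plane, so semidefiniteness becomes a condition on scalars. They later serve as the
  coefficients of a real combination of the two parts of the field.\<close>

lemma positive_semidefinite_sym_mat2:
  "positive_semidefinite (sym_mat2 a b d) \<longleftrightarrow>
    (\<forall>p q. 0 \<le> p\<^sup>2 * a + 2 * p * q * b + q\<^sup>2 * d)"
proof -
  have "transpose (sym_mat2 a b d) = sym_mat2 a b d"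
    by (simp add: sym_mat2_def transpose_def vec_eq_iff forall_2)
  moreover have "v \<bullet> (sym_mat2 a b d *v v) =
      (v $ 1)\<^sup>2 * a + 2 * v $ 1 * v $ 2 * b + (v $ 2)\<^sup>2 * d" for v
    by (simp add: sym_mat2_def inner_vec_def matrix_vector_mult_def sum_2 algebra_simps power2_eq_square)
  moreover have "(\<forall>v :: real ^ 2. R (v $ 1) (v $ 2)) \<longleftrightarrow> (\<forall>p q. R p q)" for R
    by (metis vector_2)
  ultimately show ?thesis
    unfolding positive_semidefinite_def by simp
qed

section \<open>Second moments of the field over each phase\<close>

text \<open>This is the moment \<open>A_mn\<close> of phase \<alpha>. A single indicator suffices
  because an indicator equals its own square.\<close>

definition phase_moment ::
    "(real ^ 'n) set \<Rightarrow> (2 \<Rightarrow> (real ^ 'n) set) \<Rightarrow> (real ^ 'n \<Rightarrow> complex ^ 'n) \<Rightarrow> 2 \<Rightarrow> 2 \<Rightarrow> 2 \<Rightarrow> real" where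
  "phase_moment \<Omega> P E \<alpha> m n = avg \<Omega> (\<lambda>x. indicator (P \<alpha>) x * (part m (E x) \<bullet> part n (E x)))"

lemma phase_moment_commute: "phase_moment \<Omega> P E \<alpha> m n = phase_moment \<Omega> P E \<alpha> n m"
  by (simp add: phase_moment_def inner_commute)

lemma two_phase_body_lmeasurable:
  assumes "two_phase_body \<Omega> P"
  shows "\<Omega> \<in> lmeasurable"
  using assms by (auto simp: two_phase_body_def intro: lmeasurable_open)

lemma phase_sets_lebesgue_on:
  assumes "two_phase_body \<Omega> P"
  shows "P \<alpha> \<in> sets (lebesgue_on \<Omega>)"
  using assms two_phase_body_lmeasurable[OF assms]
  by (intro sets_lebesgue_on_subset) (auto simp: two_phase_body_def)

lemma integrable_phase_inner:
  assumes "two_phase_body \<Omega> P" "square_integrable_field \<Omega> E"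
  shows "integrable (lebesgue_on \<Omega>) (\<lambda>x. indicator (P \<alpha>) x * (part m (E x) \<bullet> part n (E x)))"
  using integrable_mult_indicator[OF phase_sets_lebesgue_on[OF assms(1)]
      integrable_part_inner[OF assms(2) assms(2)]] by simp

text \<open>The matrix is the volume fraction times the covariance matrix of the two parts of
  \<open>E\<close> over the phase. Its quadratic form at \<open>p\<close>, \<open>q\<close> is the
  volume fraction times the variance of
  \<open>p *\<^sub>R part 1 (E x) + q *\<^sub>R part 2 (E x)\<close>, hence nonnegative by
  \<open>norm_avg_indicator_le\<close>.\<close>

lemma phase_covariance_psd:
  assumes body: "two_phase_body \<Omega> P" and E: "square_integrable_field \<Omega> E"
    and f: "volume_fraction \<Omega> P \<alpha> \<noteq> 0"
  shows "positive_semidefinite (sym_mat2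
     (phase_moment \<Omega> P E \<alpha> 1 1 - (norm (phase_mean \<Omega> P E \<alpha> 1))\<^sup>2 / volume_fraction \<Omega> P \<alpha>)
     (phase_moment \<Omega> P E \<alpha> 2 1
       - (phase_mean \<Omega> P E \<alpha> 1 \<bullet> phase_mean \<Omega> P E \<alpha> 2) / volume_fraction \<Omega> P \<alpha>)
     (phase_moment \<Omega> P E \<alpha> 2 2 - (norm (phase_mean \<Omega> P E \<alpha> 2))\<^sup>2 / volume_fraction \<Omega> P \<alpha>))"
  unfolding positive_semidefinite_sym_mat2
proof (intro allI)
  fix p q :: real
  define g where "g x = p *\<^sub>R part 1 (E x) + q *\<^sub>R part 2 (E x)" for x
  note L = two_phase_body_lmeasurable[OF body]
  note QM = phase_sets_lebesgue_on[OF body, of \<alpha>]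
  note ip = integrable_part[OF E L] and ii = integrable_part_inner[OF E E]
  have gg: "g x \<bullet> g x = p\<^sup>2 * (part 1 (E x) \<bullet> part 1 (E x)) + 2 * p * q * (part 2 (E x) \<bullet> part 1 (E x))
      + q\<^sup>2 * (part 2 (E x) \<bullet> part 2 (E x))" for x
    by (simp add: g_def inner_add_left inner_add_right inner_commute power2_eq_square algebra_simps)
  have "(norm (avg \<Omega> (\<lambda>x. indicator (P \<alpha>) x *\<^sub>R g x)))\<^sup>2 / volume_fraction \<Omega> P \<alpha>
      \<le> avg \<Omega> (\<lambda>x. indicator (P \<alpha>) x * (g x \<bullet> g x))"
  proof (rule norm_avg_indicator_le)
    show "integrable (lebesgue_on \<Omega>) g"
      unfolding g_def using ip by simp
    show "integrable (lebesgue_on \<Omega>) (\<lambda>x. g x \<bullet> g x)"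
      unfolding gg using ii by simp
  qed (use body L f in \<open>auto simp: two_phase_body_def volume_fraction_def\<close>)
  also have "(\<lambda>x. indicator (P \<alpha>) x *\<^sub>R g x) = (\<lambda>x. p *\<^sub>R (indicator (P \<alpha>) x *\<^sub>R part 1 (E x))
      + q *\<^sub>R (indicator (P \<alpha>) x *\<^sub>R part 2 (E x)))"
    by (simp add: g_def fun_eq_iff algebra_simps)
  also have "avg \<Omega> \<dots> = p *\<^sub>R phase_mean \<Omega> P E \<alpha> 1 + q *\<^sub>R phase_mean \<Omega> P E \<alpha> 2"
    unfolding phase_mean_def
    using integrable_mult_indicator[OF QM ip] by (simp only: avg_add avg_scaleR integrable_scaleR_right)
  also have "(norm \<dots>)\<^sup>2 = p\<^sup>2 * (norm (phase_mean \<Omega> P E \<alpha> 1))\<^sup>2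
      + 2 * p * q * (phase_mean \<Omega> P E \<alpha> 1 \<bullet> phase_mean \<Omega> P E \<alpha> 2)
      + q\<^sup>2 * (norm (phase_mean \<Omega> P E \<alpha> 2))\<^sup>2"
    unfolding power2_norm_eq_inner
    by (simp add: inner_add_left inner_add_right inner_commute power2_eq_square algebra_simps)
  also have "(\<lambda>x. indicator (P \<alpha>) x * (g x \<bullet> g x)) =
      (\<lambda>x. p\<^sup>2 * (indicator (P \<alpha>) x * (part 1 (E x) \<bullet> part 1 (E x)))
        + 2 * p * q * (indicator (P \<alpha>) x * (part 2 (E x) \<bullet> part 1 (E x)))
        + q\<^sup>2 * (indicator (P \<alpha>) x * (part 2 (E x) \<bullet> part 2 (E x))))"
    unfolding gg by (simp add: fun_eq_iff algebra_simps)
  also have "avg \<Omega> \<dots> = p\<^sup>2 * phase_moment \<Omega> P E \<alpha> 1 1 + 2 * p * q * phase_moment \<Omega> P E \<alpha> 2 1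
      + q\<^sup>2 * phase_moment \<Omega> P E \<alpha> 2 2"
    unfolding phase_moment_def
    using integrable_phase_inner[OF body E] by (simp add: avg_add avg_mult)
  finally show "0 \<le> p\<^sup>2 * (phase_moment \<Omega> P E \<alpha> 1 1
        - (norm (phase_mean \<Omega> P E \<alpha> 1))\<^sup>2 / volume_fraction \<Omega> P \<alpha>)
      + 2 * p * q * (phase_moment \<Omega> P E \<alpha> 2 1
        - (phase_mean \<Omega> P E \<alpha> 1 \<bullet> phase_mean \<Omega> P E \<alpha> 2) / volume_fraction \<Omega> P \<alpha>)
      + q\<^sup>2 * (phase_moment \<Omega> P E \<alpha> 2 2
        - (norm (phase_mean \<Omega> P E \<alpha> 2))\<^sup>2 / volume_fraction \<Omega> P \<alpha>)"
    by (simp add: add_divide_distrib right_diff_distrib)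
qed

text \<open>On phase \<alpha> the current is \<open>s \<alpha> *s E x\<close>, so its real part is
  \<open>Re (s \<alpha>)\<close> times the real part of \<open>E\<close> minus
  \<open>Im (s \<alpha>)\<close> times the imaginary part, and its imaginary part has the
  coefficients \<open>Im (s \<alpha>)\<close> and \<open>Re (s \<alpha>)\<close>. This is the source
  of the signs in \<open>system_matrix\<close>.\<close>

lemma EJ_eq_phase_moments:
  assumes body: "two_phase_body \<Omega> P" and sol: "quasistatic_solution \<Omega> (conductivity P s) E J"
  defines "A \<equiv> phase_moment \<Omega> P E"
  shows "EJ \<Omega> E J $ m $ 1 =
      Re (s 1) * A 1 m 1 + Re (s 2) * A 2 m 1 - Im (s 1) * A 1 m 2 - Im (s 2) * A 2 m 2" (is ?re)
    and "EJ \<Omega> E J $ m $ 2 =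
      Im (s 1) * A 1 m 1 + Im (s 2) * A 2 m 1 + Re (s 1) * A 1 m 2 + Re (s 2) * A 2 m 2" (is ?im)
proof -
  have E: "square_integrable_field \<Omega> E" and J: "square_integrable_field \<Omega> J"
    using sol by (auto simp: quasistatic_solution_def)
  note ii = integrable_phase_inner[OF body E]
  have ae: "AE x in lebesgue_on \<Omega>. indicator (P 1) x + indicator (P 2) x = (1::real) \<and>
      J x = conductivity P s x *s E x"
    using body sol by (auto simp: two_phase_body_def quasistatic_solution_def)
  let ?I = "\<lambda>\<alpha> n x. indicator (P \<alpha>) x * (part m (E x) \<bullet> part n (E x))"
  \<comment> \<open>Almost every point lies in exactly one phase, so only the two terms of that
    phase survive in the sum.\<close>
  have split: "(x \<in> P 1 \<and> x \<notin> P 2) \<or> (x \<notin> P 1 \<and> x \<in> P 2)"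
    if "indicator (P 1) x + indicator (P 2) x = (1::real)" for x
    using that by (auto simp: indicator_def split: if_splits)
  have "avg \<Omega> (\<lambda>x. part m (E x) \<bullet> part 1 (J x)) = avg \<Omega> (\<lambda>x. Re (s 1) * ?I 1 1 x + Re (s 2) * ?I 2 1 x
        - Im (s 1) * ?I 1 2 x - Im (s 2) * ?I 2 2 x)"
    unfolding avg_def
  proof (rule arg_cong[OF integral_cong_AE])
    show "AE x in lebesgue_on \<Omega>. part m (E x) \<bullet> part 1 (J x) =
        Re (s 1) * ?I 1 1 x + Re (s 2) * ?I 2 1 x - Im (s 1) * ?I 1 2 x - Im (s 2) * ?I 2 2 x"
      using ae by eventually_elim
        (use split in \<open>fastforce simp: conductivity_def part_vector_scale inner_diff_right\<close>)
  qed (intro borel_measurable_integrable integrable_part_inner[OF E J], use ii in simp)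
  then show ?re
    unfolding A_def phase_moment_def EJ_def using ii by (simp add: avg_add avg_diff avg_mult)
  have "avg \<Omega> (\<lambda>x. part m (E x) \<bullet> part 2 (J x)) = avg \<Omega> (\<lambda>x. Im (s 1) * ?I 1 1 x + Im (s 2) * ?I 2 1 x
        + Re (s 1) * ?I 1 2 x + Re (s 2) * ?I 2 2 x)"
    unfolding avg_def
  proof (rule arg_cong[OF integral_cong_AE])
    show "AE x in lebesgue_on \<Omega>. part m (E x) \<bullet> part 2 (J x) =
        Im (s 1) * ?I 1 1 x + Im (s 2) * ?I 2 1 x + Re (s 1) * ?I 1 2 x + Re (s 2) * ?I 2 2 x"
      using ae by eventually_elim
        (use split in \<open>fastforce simp: conductivity_def part_vector_scale inner_add_right\<close>)
  qed (intro borel_measurable_integrable integrable_part_inner[OF E J], use ii in simp)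
  then show ?im
    unfolding A_def phase_moment_def EJ_def using ii by (simp add: avg_add avg_diff avg_mult)
qed

text \<open>The sum of the two moments is the average of the squared field magnitude times the
  indicator of the phase. Below threshold this integrand is at most
  \<open>(c \<alpha>)\<^sup>2\<close> times the indicator, whose average is the volume
  fraction.\<close>

lemma phase_moment_trace_le:
  assumes body: "two_phase_body \<Omega> P" and E: "square_integrable_field \<Omega> E"
    and onset: "no_onset P c E"
  shows "phase_moment \<Omega> P E \<alpha> 1 1 + phase_moment \<Omega> P E \<alpha> 2 2 \<le> volume_fraction \<Omega> P \<alpha> * (c \<alpha>)\<^sup>2"
proof -
  interpret finite_measure "lebesgue_on \<Omega>"
    using two_phase_body_lmeasurable[OF body] by (rule finite_measure_lebesgue_on)
  have P: "P \<alpha> \<in> sets lebesgue" "P \<alpha> \<subseteq> \<Omega>" and \<Omega>: "\<Omega> \<in> sets lebesgue"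
    using body two_phase_body_lmeasurable[OF body] by (auto simp: two_phase_body_def)
  note ii = integrable_phase_inner[OF body E]
  let ?I = "\<lambda>m x. indicator (P \<alpha>) x * (part m (E x) \<bullet> part m (E x))"
  have "AE x in lebesgue_on (P \<alpha>). (norm (part 1 (E x)))\<^sup>2 + (norm (part 2 (E x)))\<^sup>2 < (c \<alpha>)\<^sup>2"
    using onset by (simp add: no_onset_def)
  \<comment> \<open>The bound is known almost everywhere in the phase only. Writing it as an
    implication moves it to the whole space and then to \<Omega>, where the averages are
    taken.\<close>
  then have "AE x in lebesgue. x \<in> P \<alpha> \<longrightarrow>
      (norm (part 1 (E x)))\<^sup>2 + (norm (part 2 (E x)))\<^sup>2 < (c \<alpha>)\<^sup>2"
    using P(1) by (subst (asm) AE_restrict_space_iff) auto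
  then have ae: "AE x in lebesgue_on \<Omega>. x \<in> P \<alpha> \<longrightarrow>
      (norm (part 1 (E x)))\<^sup>2 + (norm (part 2 (E x)))\<^sup>2 < (c \<alpha>)\<^sup>2"
    using \<Omega> by (subst AE_restrict_space_iff) auto
  have i3: "integrable (lebesgue_on \<Omega>) (indicator (P \<alpha>) :: _ \<Rightarrow> real)"
    using phase_sets_lebesgue_on[OF body, of \<alpha>]
    by (intro integrable_real_indicator) (simp_all add: emeasure_finite less_top[symmetric])
  have "integral\<^sup>L (lebesgue_on \<Omega>) (\<lambda>x. ?I 1 x + ?I 2 x)
      \<le> integral\<^sup>L (lebesgue_on \<Omega>) (\<lambda>x. indicator (P \<alpha>) x * (c \<alpha>)\<^sup>2)"
  proof (rule integral_mono_AE)
    show "AE x in lebesgue_on \<Omega>. ?I 1 x + ?I 2 x \<le> indicator (P \<alpha>) x * (c \<alpha>)\<^sup>2"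
      using ae by eventually_elim (auto simp: indicator_def power2_norm_eq_inner)
  qed (use ii i3 in auto)
  then have "inverse (measure lebesgue \<Omega>) * integral\<^sup>L (lebesgue_on \<Omega>) (\<lambda>x. ?I 1 x + ?I 2 x)
      \<le> inverse (measure lebesgue \<Omega>) * integral\<^sup>L (lebesgue_on \<Omega>) (\<lambda>x. indicator (P \<alpha>) x * (c \<alpha>)\<^sup>2)"
    by (rule mult_left_mono) simp
  also have "\<dots> = avg \<Omega> (indicator (P \<alpha>)) * (c \<alpha>)\<^sup>2"
    by (simp add: avg_def)
  finally show ?thesis
    unfolding avg_indicator[OF P \<Omega>] volume_fraction_def phase_moment_def
    using ii by (simp add: avg_def algebra_simps)
qed

section \<open>Elimination in the linear system and membership in both regions\<close>

theorem theorem4p1: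
  fixes \<Omega> :: "(real ^ 'n) set"
    and P :: "2 \<Rightarrow> (real ^ 'n) set"
    and s :: "2 \<Rightarrow> complex"
    and c :: "2 \<Rightarrow> real"
    and E J :: "real ^ 'n \<Rightarrow> complex ^ 'n"
  assumes "CARD('n) = 2 \<or> CARD('n) = 3"
    and "two_phase_body \<Omega> P"
    and "beta s \<noteq> 0"
    and "\<And>\<alpha>. volume_fraction \<Omega> P \<alpha> \<noteq> 0"
    and "\<And>\<alpha>. c \<alpha> > 0"
    and "quasistatic_solution \<Omega> (conductivity P s) E J"
    and "no_onset P c E"
  shows "feasible_region \<Omega> P s E J \<noteq> {} \<and>
         feasible_region \<Omega> P s E J \<inter> compatible_region \<Omega> P s c E J \<noteq> {}"
proof -
  note body = assms(2) and \<beta> = assms(3)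
  have E: "square_integrable_field \<Omega> E"
    using assms(6) by (simp add: quasistatic_solution_def)
  let ?A = "phase_moment \<Omega> P E" and ?W = "EJ \<Omega> E J"
  let ?x = "?A 1 1 1" and ?y = "?A 2 1 1"
  note W = EJ_eq_phase_moments[OF body assms(6)] phase_moment_commute[of \<Omega> P E _ 1 2]
  \<comment> \<open>Elimination by Cramer's rule. The combination in \<open>xi1\<close> cancels the
    mixed moment of phase 2 and leaves that of phase 1 with coefficient \<open>beta s\<close>; in
    \<open>xi2\<close> the roles are exchanged and the coefficient is \<open>- beta s\<close>. In
    \<open>eta1\<close> and \<open>eta2\<close> the mixed moments cancel altogether, and what
    remains is the trace \<open>?A \<alpha> 1 1 + ?A \<alpha> 2 2\<close> of the respective
    phase.\<close>
  have b21: "- gamma s * ?x - psi1 s * ?y + xi1 s ?W = ?A 1 2 1"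
    "psi2 s * ?x + gamma s * ?y - xi2 s ?W = ?A 2 2 1"
    and b22: "- ?x + eta1 s ?W = ?A 1 2 2" "- ?y + eta2 s ?W = ?A 2 2 2"
    using \<beta> unfolding gamma_def psi1_def psi2_def xi1_def xi2_def eta1_def eta2_def cmod_power2 W
    by (simp_all add: divide_simps) (simp_all add: beta_def algebra_simps power2_eq_square)
  have "(?x, ?y) \<in> feasible_region \<Omega> P s E J"
    using phase_covariance_psd[OF body E assms(4)]
    unfolding feasible_region_def S1_def S2_def by (simp only: mem_Collect_eq case_prod_conv b21 b22)
  moreover have "(?x, ?y) \<in> compatible_region \<Omega> P s c E J"
  proof -
    \<comment> \<open>The unknowns are the actual moments, in the order fixed by
      \<open>system_matrix\<close>. The rows are then the four identities of
      \<open>EJ_eq_phase_moments\<close>, with the terms in \<open>?x\<close> and \<open>?y\<close>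
      moved to the right-hand side.\<close>
    let ?v = "vector [?A 1 2 1, ?A 2 2 1, ?A 1 2 2, ?A 2 2 2] :: real ^ 4"
    have "system_matrix s *v ?v = system_rhs s ?W ?x ?y"
      unfolding system_matrix_def system_rhs_def W
      by (simp add: vec_eq_iff forall_4 matrix_vector_mult_def sum_4)
    moreover have "?x + ?v $ 3 \<le> volume_fraction \<Omega> P 1 * (c 1)\<^sup>2"
      "?y + ?v $ 4 \<le> volume_fraction \<Omega> P 2 * (c 2)\<^sup>2"
      using phase_moment_trace_le[OF body E assms(7)] by simp_all
    ultimately show ?thesis
      unfolding compatible_region_def by blast
  qed
  ultimately show ?thesis by blast
qed

end
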